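(* There exists an absolute constant $K<39$ such that for any algebra $\mathfrak{A}$ of finite sets and any map $\nu:\mathfrak{A}\to\mathbb{R}$ satisfying $$|\nu(A\cup B)-\nu(A)-\nu(B)|\le 1\quad\text{whenever } A,B\in\mathfrak{A},\ A\cap B=\emptyset,$$ there exists an additive set-function $\mu:\mathfrak{A}\to\mathbb{R}$ satisfying $|\nu(A)-\mu(A)|\le K$ for every $A\in\mathfrak{A}$.
   Context: A set-function $\mu:\mathfrak{A}\to\mathbb{R}$ on an algebra of sets $\mathfrak{A}$ is called additive if $\mu(A\cup B)=\mu(A)+\mu(B)$ for all $A,B\in\mathfrak{A}$ with $A\cap B=\emptyset$. "Algebra of finite sets" means an algebra of sets all of whose elements are finite sets. "Absolute constant" means that $K$ does not depend on $\mathfrak{A}$ or $\nu$. *)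

theory Defs
  imports "HOL-Analysis.Analysis"
begin

definition almost_additive :: "'a set set \<Rightarrow> ('a set \<Rightarrow> real) \<Rightarrow> bool" where
  "almost_additive M \<nu> \<longleftrightarrow>
     (\<forall>A\<in>M. \<forall>B\<in>M. A \<inter> B = {} \<longrightarrow> \<bar>\<nu> (A \<union> B) - \<nu> A - \<nu> B\<bar> \<le> 1)"

(* The type argument only names the type of points. HOL cannot quantify over types below an
   existential, so the independence of the constant from the type of points cannot be put
   inside this predicate. *)
definition approx_const :: "'a itself \<Rightarrow> real \<Rightarrow> bool" where
  "approx_const _ K \<longleftrightarrow>
     (\<forall>(\<Omega> :: 'a set) M \<nu>.
        algebra \<Omega> M \<and> (\<forall>A\<in>M. finite A) \<and> almost_additive M \<nu> \<longrightarrow>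
        (\<exists>\<mu> :: 'a set \<Rightarrow> real. additive M \<mu> \<and> (\<forall>A\<in>M. \<bar>\<nu> A - \<mu> A\<bar> \<le> K)))"

end

theory Submission
  imports Defs "HOL-Combinatorics.Permutations"
begin

text \<open>Let \<open>S\<close> be nearly the least uniform distance from \<open>\<nu>\<close> to an additive function, and replace \<open>\<nu>\<close>
  by the difference \<open>f\<close> that almost attains it. As no additive function improves on it, Farkas' lemma
  gives finite families of sets \<open>P\<close> and \<open>N\<close> that cover every point equally often, with \<open>f \<approx> S\<close> on
  average on \<open>P\<close> and \<open>f \<approx> - S\<close> on \<open>N\<close>. Replacing \<open>f\<close> by \<open>- f\<close> one may assume that \<open>N\<close> is not the
  larger family; then \<open>P\<close> together with the complements of \<open>N\<close> is a family on which \<open>f\<close> is on average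
  at least about \<open>S - 1\<close>, and each point lies in at most half of its members. A concentrator with
  \<open>10 * t\<close> inputs, \<open>8 * t\<close> outputs and \<open>40 * t\<close> edges, in which any \<open>5 * t\<close> inputs can be matched,
  recombines the members into only 4/5 as many sets. The total error of the recombination bounds
  \<open>S\<close> by about 36.\<close>

section \<open>Hall's marriage theorem\<close>

text \<open>Induction on the size of \<open>X\<close>. A nonempty proper subset that is tight is
  matched first and the rest outside its neighbourhood; if there is none, every such subset has a
  neighbour to spare, and one vertex may take any neighbour.\<close>

lemma hall:
  assumes "finite X" "\<And>v. v \<in> X \<Longrightarrow> finite (N v)"
    and "\<And>Y. Y \<subseteq> X \<Longrightarrow> card Y \<le> card (\<Union>(N ` Y))"
  shows "\<exists>g. inj_on g X \<and> (\<forall>v\<in>X. g v \<in> N v)"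
  using assms
proof (induction "card X" arbitrary: X N rule: less_induct)
  case less
  note fin = less.prems(1,2) and hall = less.prems(3)
  show ?case
  proof (cases "\<exists>Y. Y \<subset> X \<and> Y \<noteq> {} \<and> card (\<Union>(N ` Y)) \<le> card Y")
    case True
    then obtain Y where Y: "Y \<subset> X" "Y \<noteq> {}" "card (\<Union>(N ` Y)) \<le> card Y" by blast
    have finY: "finite Y" using Y fin finite_subset by blast
    have finNY: "finite (\<Union>(N ` Y))" using Y fin finY by blast
    have "\<exists>g. inj_on g Y \<and> (\<forall>v\<in>Y. g v \<in> N v)"
      using Y fin hall finY by (intro less.hyps) (auto intro: psubset_card_mono)
    then obtain g where g: "inj_on g Y" "\<And>v. v \<in> Y \<Longrightarrow> g v \<in> N v" by blast
    have "\<exists>h. inj_on h (X - Y) \<and> (\<forall>v\<in>X - Y. h v \<in> N v - \<Union>(N ` Y))"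
    proof (intro less.hyps)
      show "card (X - Y) < card X"
        using Y fin by (intro psubset_card_mono) auto
      fix Z assume Z: "Z \<subseteq> X - Y"
      have finZ: "finite Z" using Z fin finite_subset by blast
      \<comment> \<open>Hall's condition for \<open>Z \<union> Y\<close> minus the tight count for
        \<open>Y\<close> leaves the condition for \<open>Z\<close> in the reduced
        neighbourhoods.\<close>
      have "card Z + card Y = card (Z \<union> Y)"
        using Z finZ finY by (subst card_Un_disjoint) auto
      also have "\<dots> \<le> card (\<Union>(N ` (Z \<union> Y)))" using Z Y by (intro hall) auto
      also have "\<dots> \<le> card (\<Union>v\<in>Z. N v - \<Union>(N ` Y)) + card (\<Union>(N ` Y))"
      proof (rule order_trans[OF card_mono card_Un_le])
        show "finite ((\<Union>v\<in>Z. N v - \<Union>(N ` Y)) \<union> \<Union>(N ` Y))"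
          using finZ finNY Z fin by auto
      qed auto
      finally show "card Z \<le> card (\<Union>v\<in>Z. N v - \<Union>(N ` Y))" using Y(3) by linarith
    qed (use fin in auto)
    then obtain h where h: "inj_on h (X - Y)" "\<And>v. v \<in> X - Y \<Longrightarrow> h v \<in> N v - \<Union>(N ` Y)"
      by blast
    let ?k = "\<lambda>v. if v \<in> Y then g v else h v"
    have "inj_on ?k X"
    proof (rule inj_onI)
      fix u v assume uv: "u \<in> X" "v \<in> X" "?k u = ?k v"
      show "u = v"
        using uv g h inj_onD[OF g(1), of u v] inj_onD[OF h(1), of u v]
        by (cases "u \<in> Y"; cases "v \<in> Y") (auto, metis DiffD2 DiffI UN_I, metis DiffD2 DiffI UN_I)
    qed
    moreover have "\<forall>v\<in>X. ?k v \<in> N v" using g h by auto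
    ultimately show ?thesis by blast
  next
    case no_tight: False
    show ?thesis
    proof (cases "X = {}")
      case False
      then obtain x where x: "x \<in> X" by blast
      have "card {x} \<le> card (\<Union>(N ` {x}))" using x by (intro hall) auto
      then obtain w where w: "w \<in> N x" by fastforce
      have "\<exists>h. inj_on h (X - {x}) \<and> (\<forall>v\<in>X - {x}. h v \<in> N v - {w})"
      proof (intro less.hyps)
        show "card (X - {x}) < card X" using x fin by (intro psubset_card_mono) auto
        fix Z assume Z: "Z \<subseteq> X - {x}"
        show "card Z \<le> card (\<Union>v\<in>Z. N v - {w})"
        proof (cases "Z = {}")
          case False
          then have "card Z < card (\<Union>(N ` Z))"
            using no_tight Z x not_le by blast
          also have "\<dots> \<le> card (insert w (\<Union>v\<in>Z. N v - {w}))"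
            using Z fin finite_subset[of Z X] by (intro card_mono) auto
          also have "\<dots> \<le> Suc (card (\<Union>v\<in>Z. N v - {w}))" by (rule card_insert_le_m1) auto
          finally show ?thesis by simp
        qed auto
      qed (use fin in auto)
      then obtain h where h: "inj_on h (X - {x})" "\<And>v. v \<in> X - {x} \<Longrightarrow> h v \<in> N v - {w}"
        by blast
      have "inj_on (h(x := w)) X"
        using h by (auto simp: inj_on_def)
      moreover have "\<forall>v\<in>X. (h(x := w)) v \<in> N v" using w h by auto
      ultimately show ?thesis by blast
    qed auto
  qed
qed

section \<open>An integral Farkas lemma\<close>

text \<open>A pair \<open>(c, d)\<close> stands for the inequality \<open>d \<le> (\<Sum>i. c i * y i)\<close> in the unknown \<open>y\<close>.
  The left-hand sides are integral, so Fourier-Motzkin elimination only ever needs integer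
  multiples, and the certificate of infeasibility is a multiset of the given inequalities.\<close>

inductive_set int_cone :: "(('i \<Rightarrow> int) \<times> real) set \<Rightarrow> (('i \<Rightarrow> int) \<times> real) set" for C where
  base: "p \<in> C \<Longrightarrow> p \<in> int_cone C"
| add: "(c, d) \<in> int_cone C \<Longrightarrow> (c', d') \<in> int_cone C \<Longrightarrow> (\<lambda>i. c i + c' i, d + d') \<in> int_cone C"

lemma int_cone_scale:
  assumes "(c, d) \<in> int_cone C" "0 < k"
  shows "(\<lambda>i. k * c i, of_int k * d) \<in> int_cone C"
  using assms(2)
proof (induction k rule: int_gr_induct[where k = 0])
  case base
  then show ?case using assms by simp
next
  case (step k)
  from int_cone.add[OF step(2) assms(1)] show ?case by (simp add: algebra_simps)
qed

lemma int_cone_mono: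
  assumes "C' \<subseteq> int_cone C" shows "int_cone C' \<subseteq> int_cone C"
proof
  fix p assume "p \<in> int_cone C'"
  then show "p \<in> int_cone C" by induction (use assms in \<open>auto intro: int_cone.add\<close>)
qed

lemma between_finite_sets:
  fixes L U :: "real set"
  assumes "finite L" "finite U" "\<And>l u. l \<in> L \<Longrightarrow> u \<in> U \<Longrightarrow> l \<le> u"
  obtains t where "\<And>l. l \<in> L \<Longrightarrow> l \<le> t" "\<And>u. u \<in> U \<Longrightarrow> t \<le> u"
proof (cases "L = {}")
  case True
  show ?thesis
    by (rule that[of "if U = {} then 0 else Min U"]) (use True assms(2) in auto)
next
  case False
  then show ?thesis using that[of "Max L"] assms by auto
qed

text \<open>Induction on the unknowns. When none is left, infeasibility means that some inequality
  \<open>d \<le> 0\<close> has \<open>0 < d\<close>.\<close>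

lemma farkas_int:
  assumes "finite I" "finite C"
    and infeasible: "\<nexists>y :: 'i \<Rightarrow> real. \<forall>(c, d)\<in>C. d \<le> (\<Sum>i\<in>I. of_int (c i) * y i)"
  shows "\<exists>(c, d)\<in>int_cone C. (\<forall>i\<in>I. c i = 0) \<and> 0 < d"
  using assms
proof (induction I arbitrary: C rule: finite_induct)
  case empty
  then show ?case by (fastforce intro: int_cone.base simp: not_le)
next
  case (insert j I)
  note finC = insert.prems(1)
  \<comment> \<open>For \<open>p\<close> in \<open>P\<close> and \<open>q\<close> in
    \<open>Q\<close> both multipliers are positive, and the coefficients of \<open>j\<close>
    cancel.\<close>
  define comb where "comb p q = (\<lambda>i. - fst q j * fst p i + fst p j * fst q i,
      of_int (- fst q j) * snd p + of_int (fst p j) * snd q)"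
    for p q :: "('i \<Rightarrow> int) \<times> real"
  define Z P Q where "Z = {p\<in>C. fst p j = 0}" and "P = {p\<in>C. fst p j > 0}"
    and "Q = {p\<in>C. fst p j < 0}"
  define C' where "C' = Z \<union> (\<lambda>(p, q). comb p q) ` (P \<times> Q)"
  have finPQ: "finite P" "finite Q" using finC by (auto simp: P_def Q_def)
  have finC': "finite C'" using finC by (auto simp: C'_def Z_def P_def Q_def)
  have C'_cone: "C' \<subseteq> int_cone C"
  proof
    fix r assume "r \<in> C'"
    then consider "r \<in> Z" | p q where "p \<in> P" "q \<in> Q" "r = comb p q" by (auto simp: C'_def)
    then show "r \<in> int_cone C"
    proof cases
      case 1 then show ?thesis by (auto simp: Z_def intro: int_cone.base)
    next
      case 2
      have "(\<lambda>i. - fst q j * fst p i, of_int (- fst q j) * snd p) \<in> int_cone C"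
        using 2 by (intro int_cone_scale) (auto simp: P_def Q_def intro: int_cone.base)
      moreover have "(\<lambda>i. fst p j * fst q i, of_int (fst p j) * snd q) \<in> int_cone C"
        using 2 by (intro int_cone_scale) (auto simp: P_def Q_def intro: int_cone.base)
      ultimately show ?thesis unfolding 2 comb_def by (rule int_cone.add)
    qed
  qed
  have C'_zero: "fst p j = 0" if "p \<in> int_cone C'" for p
    using that by induction (auto simp: C'_def Z_def comb_def)
  have "\<nexists>y :: 'i \<Rightarrow> real. \<forall>(c, d)\<in>C'. d \<le> (\<Sum>i\<in>I. of_int (c i) * y i)"
  proof
    assume "\<exists>y :: 'i \<Rightarrow> real. \<forall>(c, d)\<in>C'. d \<le> (\<Sum>i\<in>I. of_int (c i) * y i)"
    then obtain y :: "'i \<Rightarrow> real" where y: "\<And>p. p \<in> C' \<Longrightarrow> snd p \<le> (\<Sum>i\<in>I. of_int (fst p i) * y i)"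
      by fastforce
    define S where "S p = (\<Sum>i\<in>I. of_int (fst p i) * y i)" for p :: "('i \<Rightarrow> int) \<times> real"
    \<comment> \<open>\<open>r p\<close> is the bound that \<open>p\<close> puts on the value at
      \<open>j\<close> once the other values are fixed: a lower bound for \<open>P\<close>, an upper
      one for \<open>Q\<close>. The combined inequalities say that no lower bound exceeds an upper
      one.\<close>
    define r where "r p = (snd p - S p) / of_int (fst p j)" for p
    obtain t where t: "\<And>l. l \<in> r ` P \<Longrightarrow> l \<le> t" "\<And>u. u \<in> r ` Q \<Longrightarrow> t \<le> u"
    proof (rule between_finite_sets[of "r ` P" "r ` Q"])
      fix l u assume "l \<in> r ` P" "u \<in> r ` Q"
      then obtain p q where pq: "p \<in> P" "q \<in> Q" and lu: "l = r p" "u = r q" by blast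
      have "snd (comb p q) \<le> (\<Sum>i\<in>I. of_int (fst (comb p q) i) * y i)"
        using pq by (intro y) (auto simp: C'_def)
      also have "\<dots> = - of_int (fst q j) * S p + of_int (fst p j) * S q"
        by (simp add: comb_def S_def sum_distrib_left sum.distrib sum_subtractf sum_negf algebra_simps)
      finally have "of_int (- fst q j) * (snd p - S p) \<le> of_int (fst p j) * (S q - snd q)"
        by (simp add: comb_def algebra_simps)
      then show "l \<le> u" using pq by (simp add: lu r_def P_def Q_def field_simps)
    qed (use finPQ in auto)
    have "\<forall>(c, d)\<in>C. d \<le> (\<Sum>i\<in>insert j I. of_int (c i) * (y(j := t)) i)"
    proof safe
      fix c d assume cd: "(c, d) \<in> C"
      have "(\<Sum>i\<in>insert j I. of_int (c i) * (y(j := t)) i) = of_int (c j) * t + S (c, d)"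
        using insert.hyps by (auto simp: S_def intro!: sum.cong)
      moreover have "d \<le> of_int (c j) * t + S (c, d)"
      proof (cases "c j" "0 :: int" rule: linorder_cases)
        case less
        then have "t \<le> r (c, d)" using cd t by (auto simp: Q_def)
        then show ?thesis using less by (simp add: r_def field_simps)
      next
        case equal
        then show ?thesis using y[of "(c, d)"] cd by (auto simp: S_def C'_def Z_def)
      next
        case greater
        then have "r (c, d) \<le> t" using cd t by (auto simp: P_def)
        then show ?thesis using greater by (simp add: r_def field_simps)
      qed
      ultimately show "d \<le> (\<Sum>i\<in>insert j I. of_int (c i) * (y(j := t)) i)" by simp
    qed
    then show False using insert.prems(2) by blast
  qed
  from insert.IH[OF finC' this] obtain c d
    where "(c, d) \<in> int_cone C'" "\<forall>i\<in>I. c i = 0" "0 < d" by blast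
  then show ?case using C'_zero int_cone_mono[OF C'_cone] by fastforce
qed

section \<open>Concentrators from random permutations\<close>

lemma exists_permutes_image_eq:
  assumes "finite S" "A \<subseteq> S" "B \<subseteq> S" "card A = card B"
  obtains \<sigma> where "\<sigma> permutes S" "\<sigma> ` A = B"
proof -
  have fin: "finite A" "finite B" using assms finite_subset by blast+
  obtain f where f: "bij_betw f A B" using fin assms(4) finite_same_card_bij by blast
  have "card (S - A) = card (S - B)" using assms fin by (simp add: card_Diff_subset)
  then obtain g where g: "bij_betw g (S - A) (S - B)"
    using assms(1) finite_same_card_bij[of "S - A" "S - B"] by blast
  define \<sigma> where "\<sigma> x = (if x \<in> A then f x else if x \<in> S then g x else x)" for x
  have \<sigma>A: "bij_betw \<sigma> A B" using f by (rule bij_betw_cong[THEN iffD1, rotated]) (simp add: \<sigma>_def)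
  moreover have "bij_betw \<sigma> (S - A) (S - B)"
    using g by (rule bij_betw_cong[THEN iffD1, rotated]) (simp add: \<sigma>_def)
  ultimately have "bij_betw \<sigma> (A \<union> (S - A)) (B \<union> (S - B))"
    by (rule bij_betw_combine) auto
  moreover have "A \<union> (S - A) = S" "B \<union> (S - B) = S" using assms by auto
  ultimately have "bij_betw \<sigma> S S" by simp
  then have "\<sigma> permutes S"
    by (rule bij_imp_permutes) (use assms in \<open>auto simp: \<sigma>_def\<close>)
  with \<sigma>A show ?thesis using that by (auto simp: bij_betw_def)
qed

text \<open>Composition with a permutation carrying \<open>D\<close> to \<open>D'\<close> shows that
  all images of the right size are equally frequent.\<close>

lemma card_permutes_image_eq:
  assumes S: "finite S" and A: "A \<subseteq> S" and C: "C \<subseteq> S" "card C = card A"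
  shows "card {p. p permutes S \<and> p ` A = C} * (card S choose card A) = fact (card S)"
proof -
  let ?P = "\<lambda>D. {p. p permutes S \<and> p ` A = D}"
  let ?\<D> = "{D. D \<subseteq> S \<and> card D = card A}"
  have finP: "finite (?P D)" for D
    using finite_permutations[OF S] by (rule rev_finite_subset) auto
  have le: "card (?P D) \<le> card (?P D')"
    if D: "D \<subseteq> S" "D' \<subseteq> S" "card D = card D'" for D D'
  proof -
    obtain \<sigma> where \<sigma>: "\<sigma> permutes S" "\<sigma> ` D = D'"
      using exists_permutes_image_eq[OF S D] by blast
    show ?thesis
    proof (rule card_inj_on_le[of "\<lambda>p. \<sigma> \<circ> p"])
      show "inj_on (\<lambda>p. \<sigma> \<circ> p) (?P D)"
        using permutes_inj[OF \<sigma>(1)] by (auto simp: inj_on_def fun_eq_iff inj_def)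
      show "(\<lambda>p. \<sigma> \<circ> p) ` ?P D \<subseteq> ?P D'"
        using \<sigma> by (auto simp: image_comp[symmetric] intro: permutes_compose)
    qed (rule finP)
  qed
  have "fact (card S) = card (\<Union>D\<in>?\<D>. ?P D)"
  proof -
    have "(\<Union>D\<in>?\<D>. ?P D) = {p. p permutes S}"
    proof safe
      fix p assume p: "p permutes S"
      then have "p ` A \<in> ?\<D>"
        using A permutes_image[OF p] by (auto simp: card_image permutes_inj_on[OF p])
      then show "p \<in> (\<Union>D\<in>?\<D>. ?P D)" using p by blast
    qed
    then show ?thesis using card_permutations[OF refl S] by simp
  qed
  also have "\<dots> = (\<Sum>D\<in>?\<D>. card (?P D))"
    using S finP by (intro card_UN_disjoint) auto
  also have "\<dots> = (\<Sum>D\<in>?\<D>. card (?P C))"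
    using C by (intro sum.cong refl antisym le) auto
  also have "\<dots> = card (?P C) * (card S choose card A)"
    using S by (simp add: n_subsets)
  finally show ?thesis by simp
qed

text \<open>Summing over the images inside \<open>B\<close> gives the probability of landing in
  \<open>B\<close> as a quotient of binomial coefficients.\<close>

lemma card_permutes_image_subset:
  assumes S: "finite S" and A: "A \<subseteq> S" and B: "B \<subseteq> S"
  shows "card {p. p permutes S \<and> p ` A \<subseteq> B} * (card S choose card A)
         = (card B choose card A) * fact (card S)"
proof -
  let ?P = "\<lambda>D. {p. p permutes S \<and> p ` A = D}"
  let ?\<D> = "{D. D \<subseteq> B \<and> card D = card A}"
  have finB: "finite B" using S B finite_subset by blast
  have finP: "finite (?P D)" for D
    using finite_permutations[OF S] by (rule rev_finite_subset) auto
  have "{p. p permutes S \<and> p ` A \<subseteq> B} = (\<Union>D\<in>?\<D>. ?P D)"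
    by (auto simp: card_image permutes_inj_on)
  moreover have "card (\<Union>D\<in>?\<D>. ?P D) = (\<Sum>D\<in>?\<D>. card (?P D))"
    using finB finP by (intro card_UN_disjoint) auto
  ultimately have "card {p. p permutes S \<and> p ` A \<subseteq> B} * (card S choose card A)
     = (\<Sum>D\<in>?\<D>. card (?P D) * (card S choose card A))"
    by (simp add: sum_distrib_right)
  also have "\<dots> = (\<Sum>D\<in>?\<D>. fact (card S))"
    using assms by (intro sum.cong refl card_permutes_image_eq) auto
  finally show ?thesis using finB by (simp add: n_subsets)
qed

section \<open>Binomial estimates for the union bound\<close>

lemma binomial_mult_le: "(m choose i) * (n choose j) \<le> (m + n) choose (i + j)"
proof -
  have "(m choose i) * (n choose j) = (m choose i) * (n choose (i + j - i))" by simp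
  also have "\<dots> \<le> (\<Sum>k\<le>i + j. (m choose k) * (n choose (i + j - k)))"
    by (rule member_le_sum[where f = "\<lambda>k. (m choose k) * (n choose (i + j - k))"]) auto
  finally show ?thesis by (simp add: vandermonde)
qed

lemma binomial_power4_le: "(n choose k) ^ 4 \<le> (4 * n) choose (4 * k)"
proof -
  have "(n choose k) ^ 4 = ((n choose k) * (n choose k)) * ((n choose k) * (n choose k))"
    by (simp add: eval_nat_numeral)
  also have "\<dots> \<le> ((n + n) choose (k + k)) * ((n + n) choose (k + k))"
    by (intro mult_mono binomial_mult_le) auto
  also have "\<dots> \<le> ((n + n) + (n + n)) choose ((k + k) + (k + k))"
    by (rule binomial_mult_le)
  also have "\<dots> = (4 * n) choose (4 * k)" by (rule arg_cong2[where f = binomial]) auto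
  finally show ?thesis .
qed

lemma Suc_mult_binomial_Suc: "Suc k * (n choose Suc k) = (n - k) * (n choose k)"
  using binomial_absorb_comp[of n k] Suc_times_binomial_eq[of "n - 1" k] times_binomial_minus1_eq[of "Suc k" n]
  by (cases n) auto

text \<open>Raising \<open>k\<close> by 1 multiplies the two binomials by factors in the ratio
  \<open>8 * t - k\<close> to \<open>10 * t - k\<close>, at most 4 to 5.\<close>

lemma binomial_ratio_le: "5 ^ k * ((8 * t) choose k) \<le> 4 ^ k * ((10 * t) choose k)"
proof (induction k)
  case (Suc k)
  have "Suc k * (5 ^ Suc k * ((8 * t) choose Suc k)) = 5 * (8 * t - k) * (5 ^ k * ((8 * t) choose k))"
    by (subst mult.left_commute) (simp only: Suc_mult_binomial_Suc power_Suc ac_simps)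
  also have "\<dots> \<le> 4 * (10 * t - k) * (4 ^ k * ((10 * t) choose k))"
    by (rule mult_le_mono[OF _ Suc]) arith
  also have "\<dots> = Suc k * (4 ^ Suc k * ((10 * t) choose Suc k))"
    by (subst (2) mult.left_commute) (simp only: Suc_mult_binomial_Suc power_Suc ac_simps)
  finally show ?case by (simp only: mult_le_cancel1)
qed auto

text \<open>One term of the expansion of \<open>(1 + 4) ^ (5 * k)\<close>, with
  \<open>256 = 4 ^ 4\<close> and \<open>3125 = 5 ^ 5\<close>.\<close>

lemma binomial_5_1_le: "256 ^ k * ((5 * k) choose k) \<le> 3125 ^ k"
proof -
  have "256 ^ k * ((5 * k) choose k) = ((5 * k) choose k) * 1 ^ k * 4 ^ (5 * k - k)"
    by (simp add: power_mult[of 4 4 k, simplified])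
  also have "\<dots> \<le> (\<Sum>j\<le>5 * k. ((5 * k) choose j) * 1 ^ j * 4 ^ (5 * k - j))"
    by (rule member_le_sum[where f = "\<lambda>j. ((5 * k) choose j) * 1 ^ j * 4 ^ (5 * k - j)"]) auto
  also have "\<dots> = (1 + 4) ^ (5 * k)" using binomial[of 1 4 "5 * k"] by simp
  finally show ?thesis by (simp add: power_mult)
qed

text \<open>The expected number of pairs \<open>(X, Y)\<close> with \<open>card X = card Y = k\<close> such that all neighbours of
  \<open>X\<close> lie in \<open>Y\<close>, when \<open>10 * t\<close> inputs of degree 4 and \<open>8 * t\<close> outputs of degree 5 are joined by a
  random bijection of their \<open>40 * t\<close> half-edges.\<close>

definition bad_ratio :: "nat \<Rightarrow> nat \<Rightarrow> real" where
  "bad_ratio t k = real ((10 * t) choose k) * real ((8 * t) choose k) * real ((5 * k) choose (4 * k))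
     / real ((40 * t) choose (4 * k))"

text \<open>The denominator is at least the fourth power of \<open>(10 * t) choose k\<close>, the
  numerator at most its square times the \<open>k\<close>-th power of
  \<open>4 / 5 * (3125 / 256) = 625 / 64\<close>.\<close>

lemma bad_ratio_le:
  assumes "k \<le> 5 * t"
  shows "bad_ratio t k \<le> (625 / 64) ^ k / real ((10 * t) choose k) ^ 2"
proof -
  define b where "b = real ((10 * t) choose k)"
  have b: "b > 0" using assms by (simp add: b_def)
  have "(5 * k) choose (4 * k) = (5 * k) choose k"
    using binomial_symmetric[of k "5 * k"] by simp
  moreover have "real (256 ^ k * ((5 * k) choose k)) \<le> real (3125 ^ k)"
    using binomial_5_1_le by (rule of_nat_mono)
  ultimately have c: "real ((5 * k) choose (4 * k)) \<le> (3125 / 256) ^ k"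
    by (simp add: power_divide field_simps)
  have "real (5 ^ k * ((8 * t) choose k)) \<le> real (4 ^ k * ((10 * t) choose k))"
    using binomial_ratio_le by (rule of_nat_mono)
  then have d: "real ((8 * t) choose k) \<le> (4 / 5) ^ k * b"
    by (simp add: power_divide field_simps b_def)
  have "real (((10 * t) choose k) ^ 4) \<le> real ((40 * t) choose (4 * k))"
    using binomial_power4_le[of "10 * t" k] by (intro of_nat_mono) simp
  then have e: "b ^ 4 \<le> real ((40 * t) choose (4 * k))" by (simp add: b_def)
  have "bad_ratio t k \<le> b * ((4 / 5) ^ k * b) * (3125 / 256) ^ k / b ^ 4"
    unfolding bad_ratio_def b_def[symmetric]
    using b c d e by (intro frac_le mult_mono) auto
  also have "\<dots> = ((4 / 5) * (3125 / 256)) ^ k / b ^ 2"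
    using b by (simp only: power_mult_distrib) (simp add: field_simps eval_nat_numeral)
  finally show ?thesis by (simp add: b_def)
qed

text \<open>As \<open>2 * k \<le> 10 * t\<close>, a central binomial coefficient bounds
  \<open>(10 * t) choose k\<close> from below. Its square contributes \<open>16 ^ k\<close> up to a
  polynomial factor, which brings the base below 1.\<close>

lemma bad_ratio_le_geometric:
  assumes "0 < k" "k \<le> 5 * t"
  shows "bad_ratio t k \<le> 4 * real k ^ 2 * (625 / 1024) ^ k"
proof -
  have "4 ^ k / (2 * real k) \<le> real ((2 * k) choose k)"
    using central_binomial_lower_bound[OF assms(1)] by simp
  also have "\<dots> \<le> real ((10 * t) choose k)"
    using assms by (intro of_nat_mono binomial_right_mono) simp
  finally have "(4 ^ k / (2 * real k)) ^ 2 \<le> real ((10 * t) choose k) ^ 2"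
    by (intro power_mono) auto
  then have "bad_ratio t k \<le> (625 / 64) ^ k / (4 ^ k / (2 * real k)) ^ 2"
    using assms by (intro order_trans[OF bad_ratio_le] frac_le) auto
  also have "\<dots> = 4 * real k ^ 2 * ((625 / 64) ^ k / 16 ^ k)"
    by (simp add: power_divide power2_eq_square power_mult_distrib[symmetric])
  also have "(625 / 64 :: real) ^ k / 16 ^ k = (625 / 1024) ^ k"
    by (simp add: power_divide[symmetric])
  finally show ?thesis .
qed

text \<open>Used for bounded \<open>k\<close>, where the bound tends to 0 as \<open>t\<close>
  grows.\<close>

lemma bad_ratio_le_inverse_square:
  assumes "0 < k" "k \<le> 5 * t"
  shows "bad_ratio t k \<le> (625 / 64) ^ k / real t ^ 2"
proof -
  have "real t \<le> real ((10 * t) choose 1)" by simp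
  also have "\<dots> \<le> real ((10 * t) choose k)"
    using assms by (intro of_nat_mono binomial_mono) auto
  finally have "real t ^ 2 \<le> real ((10 * t) choose k) ^ 2" by (intro power_mono) auto
  then show ?thesis
    using assms by (intro order_trans[OF bad_ratio_le] frac_le) auto
qed

text \<open>The geometric bound makes the tail of the sum small uniformly in \<open>t\<close>; the finitely many
  remaining terms tend to 0 as \<open>t\<close> grows.\<close>

lemma sum_bad_ratio_less_1: "\<forall>\<^sub>F t in sequentially. (\<Sum>k=1..5*t. bad_ratio t k) < 1"
proof -
  let ?g = "\<lambda>k. 4 * real k ^ 2 * (625 / 1024) ^ k"
  have "summable ?g"
  \<comment> \<open>From \<open>n = 5\<close> on \<open>(n + 1) / n \<le> 6 / 5\<close>, and
    \<open>36 / 25 * (625 / 1024) = 900 / 1024 < 1\<close>.\<close>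
  proof (rule summable_ratio_test[of "36 / 25 * (625 / 1024)" 5])
    fix n :: nat assume n: "5 \<le> n"
    have "real (Suc n) ^ 2 \<le> (6 / 5 * real n) ^ 2" using n by (intro power_mono) auto
    then have "real (Suc n) ^ 2 * (625 / 1024) ^ n \<le> (6 / 5 * real n) ^ 2 * (625 / 1024) ^ n"
      by (intro mult_right_mono) auto
    then show "norm (?g (Suc n)) \<le> 36 / 25 * (625 / 1024) * norm (?g n)"
      by (simp add: power_mult_distrib power_divide)
  qed simp
  then obtain k0 where k0: "\<And>n. n \<ge> k0 \<Longrightarrow> norm (sum ?g {n..<m}) < 1 / 2" for m
    using summable_Cauchy[THEN iffD1, rule_format, of ?g "1 / 2"] by auto
  have "(\<lambda>t. (\<Sum>k<k0. (625 / 64) ^ k) / real t ^ 2) \<longlonglongrightarrow> 0"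
    by (intro tendsto_divide_0[OF tendsto_const] filterlim_at_top_imp_at_infinity
        filterlim_pow_at_top filterlim_real_sequentially) simp
  then have "\<forall>\<^sub>F t in sequentially. (\<Sum>k<k0. (625 / 64) ^ k) / real t ^ 2 < 1 / 2"
    by (rule order_tendstoD) simp
  then show ?thesis
  proof (rule eventually_mono)
    fix t assume t: "(\<Sum>k<k0. (625 / 64) ^ k) / real t ^ 2 < 1 / 2"
    let ?I = "{1..5 * t}"
    have "(\<Sum>k\<in>?I. bad_ratio t k)
        = (\<Sum>k\<in>?I \<inter> {..<k0}. bad_ratio t k) + (\<Sum>k\<in>?I - {..<k0}. bad_ratio t k)"
      by (rule sum.Int_Diff) simp
    also have "(\<Sum>k\<in>?I \<inter> {..<k0}. bad_ratio t k) \<le> (\<Sum>k\<in>?I \<inter> {..<k0}. (625 / 64) ^ k / real t ^ 2)"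
      by (intro sum_mono bad_ratio_le_inverse_square) auto
    also have "\<dots> \<le> (\<Sum>k<k0. (625 / 64) ^ k / real t ^ 2)"
      by (intro sum_mono2) auto
    also have "(\<Sum>k\<in>?I - {..<k0}. bad_ratio t k) \<le> (\<Sum>k\<in>?I - {..<k0}. ?g k)"
      by (intro sum_mono bad_ratio_le_geometric) auto
    also have "\<dots> \<le> (\<Sum>k\<in>{k0..<Suc (5 * t)}. ?g k)"
      by (intro sum_mono2) auto
    also have "\<dots> < 1 / 2" using k0[of k0 "Suc (5 * t)"] by simp
    also have "(\<Sum>k<k0. (625 / 64) ^ k / real t ^ 2) < 1 / 2"
      using t by (simp add: sum_divide_distrib)
    finally show "(\<Sum>k\<in>?I. bad_ratio t k) < 1" by simp
  qed
qed

section \<open>Existence of concentrators\<close>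

definition concentrator :: "nat \<Rightarrow> (nat \<times> nat) set \<Rightarrow> bool" where
  "concentrator t E \<longleftrightarrow> E \<subseteq> {..<10*t} \<times> {..<8*t} \<and> card E \<le> 40 * t \<and>
     (\<forall>X\<subseteq>{..<10*t}. card X \<le> 5 * t \<longrightarrow> (\<exists>g. inj_on g X \<and> (\<forall>v\<in>X. (v, g v) \<in> E)))"

text \<open>Half-edges are numbered so that \<open>x\<close> belongs to the vertex
  \<open>x div d\<close>.\<close>

lemma card_div_fibres:
  assumes "X \<subseteq> {..<n}" "0 < d"
  shows "card {x. x < d * n \<and> x div d \<in> X} = d * card X"
proof -
  have "bij_betw (\<lambda>(q, r). d * q + r) (X \<times> {..<d}) {x. x < d * n \<and> x div d \<in> X}"
  proof (rule bij_betw_byWitness[where f' = "\<lambda>x. (x div d, x mod d)"])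
    show "(\<lambda>(q, r). d * q + r) ` (X \<times> {..<d}) \<subseteq> {x. x < d * n \<and> x div d \<in> X}"
    proof safe
      fix q r assume "q \<in> X" "r < d"
      then have "q + 1 \<le> n" using assms by auto
      then have "d * (q + 1) \<le> d * n" by (rule mult_le_mono2)
      then show "d * q + r < d * n" using \<open>r < d\<close> by simp
    qed auto
  qed (use assms in auto)
  from bij_betw_same_card[OF this] show ?thesis by (simp add: card_cartesian_product mult.commute)
qed

text \<open>By the union bound some permutation \<open>p\<close> of the half-edges has no bad pair;
  joining input \<open>x div 4\<close> to output \<open>p x div 5\<close> gives a graph to which
  Hall's theorem applies. Parallel edges merge, so \<open>card E\<close> is only bounded
  above.\<close>

lemma exists_concentrator: 
  assumes "(\<Sum>k=1..5*t. bad_ratio t k) < 1"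
  shows "\<exists>E. concentrator t E"
proof -
  define S where "S = {..<40 * t}"
  have S: "finite S" "card S = 40 * t" by (auto simp: S_def)
  define L R where "L X = {x. x < 40 * t \<and> x div 4 \<in> X}" and "R Y = {y. y < 40 * t \<and> y div 5 \<in> Y}"
    for X Y :: "nat set"
  have cardL: "card (L X) = 4 * card X" if "X \<subseteq> {..<10 * t}" for X
    using card_div_fibres[OF that, of 4] by (simp add: L_def)
  have cardR: "card (R Y) = 5 * card Y" if "Y \<subseteq> {..<8 * t}" for Y
    using card_div_fibres[OF that, of 5] by (simp add: R_def)
  define Sub where "Sub n k = {X. X \<subseteq> {..<n} \<and> card X = k}" for n k :: nat
  have finSub: "finite (Sub n k)" and cardSub: "card (Sub n k) = n choose k" for n k
    using n_subsets[of "{..<n}" k] by (auto simp: Sub_def)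
  define bad where "bad X Y = {p. p permutes S \<and> p ` L X \<subseteq> R Y}" for X Y
  define Bad where "Bad = (\<Union>k\<in>{1..5*t}. \<Union>X\<in>Sub (10*t) k. \<Union>Y\<in>Sub (8*t) k. bad X Y)"
  have card_bad: "real (card (bad X Y)) = fact (40 * t) *
      (real ((5 * k) choose (4 * k)) / real ((40 * t) choose (4 * k)))"
    if "k \<le> 5 * t" "X \<in> Sub (10*t) k" "Y \<in> Sub (8*t) k" for X Y k
  proof -
    have "card (bad X Y) * (card S choose card (L X)) = (card (R Y) choose card (L X)) * fact (card S)"
      unfolding bad_def by (rule card_permutes_image_subset) (auto simp: S_def L_def R_def)
    then have "real (card (bad X Y) * ((40 * t) choose (4 * k)))
        = real (((5 * k) choose (4 * k)) * fact (40 * t))"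
      using that S cardL[of X] cardR[of Y] by (simp add: Sub_def)
    moreover have "real ((40 * t) choose (4 * k)) > 0" using that by simp
    ultimately show ?thesis by (simp add: field_simps)
  qed
  have "real (card Bad) \<le> (\<Sum>k=1..5*t. \<Sum>X\<in>Sub (10*t) k. \<Sum>Y\<in>Sub (8*t) k. real (card (bad X Y)))"
    unfolding Bad_def of_nat_sum[symmetric] of_nat_le_iff
    by (intro order_trans[OF card_UN_le] sum_mono finSub finite_atLeastAtMost order_refl)
  also have "\<dots> = (\<Sum>k=1..5*t. \<Sum>X\<in>Sub (10*t) k. \<Sum>Y\<in>Sub (8*t) k. fact (40 * t) *
      (real ((5 * k) choose (4 * k)) / real ((40 * t) choose (4 * k))))"
    by (intro sum.cong refl card_bad) auto
  also have "\<dots> = (\<Sum>k=1..5*t. fact (40 * t) * bad_ratio t k)"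
    by (simp add: cardSub bad_ratio_def mult_ac)
  also have "\<dots> = fact (40 * t) * (\<Sum>k=1..5*t. bad_ratio t k)" by (simp add: sum_distrib_left)
  also have "\<dots> < fact (40 * t)" using assms by simp
  finally have "card Bad < fact (40 * t)" by (metis of_nat_fact of_nat_less_iff)
  also have "\<dots> = card {p. p permutes S}" using card_permutations[OF S(2,1)] by simp
  finally have "Bad \<noteq> {p. p permutes S}" by auto
  moreover have "Bad \<subseteq> {p. p permutes S}" by (auto simp: Bad_def bad_def)
  ultimately obtain p where p: "p permutes S" "p \<notin> Bad" by blast
  define E where "E = (\<lambda>x. (x div 4, p x div 5)) ` S"
  have pS: "p x < 40 * t" if "x < 40 * t" for x
    using permutes_in_image[OF p(1), of x] that by (simp add: S_def)
  have Esub: "E \<subseteq> {..<10*t} \<times> {..<8*t}"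
    using pS by (fastforce simp: E_def S_def)
  have "\<exists>g. inj_on g X \<and> (\<forall>v\<in>X. (v, g v) \<in> E)" if X: "X \<subseteq> {..<10*t}" "card X \<le> 5 * t" for X
  proof -
    have finE: "finite (E `` {v})" for v
      by (rule finite_subset[of _ "{..<8*t}"]) (use Esub in auto)
    have "\<exists>g. inj_on g X \<and> (\<forall>v\<in>X. g v \<in> E `` {v})"
    proof (rule hall)
      show "finite X" using X finite_subset by blast
      fix Z assume Z: "Z \<subseteq> X"
      have Zk: "card Z \<le> 5 * t" using card_mono[OF \<open>finite X\<close> Z] X by simp
      show "card Z \<le> card (\<Union>v\<in>Z. E `` {v})"
      proof (rule ccontr)
        assume *: "\<not> card Z \<le> card (\<Union>v\<in>Z. E `` {v})"
        \<comment> \<open>The neighbours of a violating \<open>Z\<close> are too few; padding them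
          to exactly \<open>card Z\<close> outputs, possible as
          \<open>card Z \<le> 5 * t \<le> 8 * t\<close>, produces a bad pair.\<close>
        have "\<exists>Y. (\<Union>v\<in>Z. E `` {v}) \<subseteq> Y \<and> Y \<subseteq> {..<8*t} \<and> card Y = card Z"
          using * Zk Esub by (intro exists_subset_between) auto
        then obtain Y where Y: "(\<Union>v\<in>Z. E `` {v}) \<subseteq> Y" "Y \<subseteq> {..<8*t}" "card Y = card Z" by blast
        have "p \<in> bad Z Y"
          using p(1) Y(1) pS by (fastforce simp: bad_def L_def R_def E_def S_def)
        moreover have "Z \<in> Sub (10*t) (card Z)" "Y \<in> Sub (8*t) (card Z)" "card Z \<in> {1..5*t}"
          using Z X Y * Zk by (auto simp: Sub_def)
        ultimately have "p \<in> Bad" unfolding Bad_def by blast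
        then show False using p by blast
      qed
    qed (rule finE)
    then show ?thesis by simp
  qed
  moreover have "card E \<le> 40 * t" using card_image_le[OF S(1)] S(2) by (metis E_def)
  ultimately show ?thesis using Esub unfolding concentrator_def by blast
qed

section \<open>Almost additive set functions\<close>

text \<open>The union takes \<open>card I - 1\<close> disjoint unions, each with error at most
  1.\<close>

lemma almost_additive_UN:
  assumes "algebra \<Omega> M" "almost_additive M f" "finite I" "I \<noteq> {}"
    "A ` I \<subseteq> M" "disjoint_family_on A I"
  shows "\<bar>f (\<Union>i\<in>I. A i) - (\<Sum>i\<in>I. f (A i))\<bar> \<le> real (card I) - 1"
  using assms(3-)
proof (induction I rule: finite_ne_induct)
  case (insert j I)
  interpret algebra \<Omega> M by fact
  have "A j \<inter> A i = {}" if "i \<in> I" for i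
    by (rule disjoint_family_onD[OF insert.prems(2)]) (use insert.hyps(3) that in auto)
  then have "A j \<inter> (\<Union>i\<in>I. A i) = {}" by blast
  moreover have "(\<Union>i\<in>I. A i) \<in> M"
    using insert.prems(1) insert.hyps(1) by (intro finite_UN) auto
  moreover have "A j \<in> M" using insert.prems(1) by simp
  ultimately have "\<bar>f (A j \<union> (\<Union>i\<in>I. A i)) - f (A j) - f (\<Union>i\<in>I. A i)\<bar> \<le> 1"
    using assms(2) by (simp add: almost_additive_def)
  moreover have "\<bar>f (\<Union>i\<in>I. A i) - (\<Sum>i\<in>I. f (A i))\<bar> \<le> real (card I) - 1"
  proof (rule insert.IH)
    show "disjoint_family_on A I"
      using insert.prems(2) by (rule disjoint_family_on_mono[rotated]) auto
  qed (use insert.prems(1) in simp)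
  moreover have "(\<Sum>i\<in>insert j I. f (A i)) = f (A j) + (\<Sum>i\<in>I. f (A i))"
    "real (card (insert j I)) = real (card I) + 1"
    using insert.hyps by simp_all
  ultimately show ?case unfolding UN_insert by linarith
qed simp

text \<open>For each point \<open>i\<close> match the indices \<open>v\<close> with \<open>i \<in> A v\<close> into the outputs. This cuts every
  \<open>A v\<close> into disjoint pieces, one per edge at \<open>v\<close>; the pieces of the edges at an output are again
  disjoint, because the matchings are injective. Regrouping the pieces there replaces the sets
  \<open>A v\<close> by fewer sets, each of value at most \<open>S\<close>.\<close>

lemma sum_le_of_concentrator:
  assumes alg: "algebra \<Omega> M" and f: "almost_additive M f" "\<And>B. B \<in> M \<Longrightarrow> f B \<le> S"
    and S: "1 \<le> S" and t: "0 < t" and E: "concentrator t E"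
    and A: "\<And>v. v < 10 * t \<Longrightarrow> A v \<in> M"
    and half: "\<And>i. i \<in> \<Omega> \<Longrightarrow> card {v. v < 10 * t \<and> i \<in> A v} \<le> 5 * t"
  shows "(\<Sum>v<10 * t. f (A v)) \<le> 70 * real t + 8 * real t * (S - 1)"
proof -
  interpret algebra \<Omega> M by fact
  define V where "V = {..<10 * t}"
  have E': "E \<subseteq> V \<times> {..<8 * t}" "card E \<le> 40 * t"
    using E by (auto simp: concentrator_def V_def)
  then have finE: "finite E" using finite_subset unfolding V_def by blast
  \<comment> \<open>The matching at a point \<open>i\<close> is made to depend on
    \<open>pat i\<close> alone. Each piece is then a finite union of atoms
    \<open>{i\<in>\<Omega>. pat i = X}\<close> and so lies in \<open>M\<close>.\<close>
  have "\<forall>X. \<exists>g. X \<subseteq> V \<longrightarrow> card X \<le> 5 * t \<longrightarrow> inj_on g X \<and> (\<forall>v\<in>X. (v, g v) \<in> E)"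
    using E by (auto simp: concentrator_def V_def)
  then obtain G where G: "\<And>X. X \<subseteq> V \<Longrightarrow> card X \<le> 5 * t \<Longrightarrow>
      inj_on (G X) X \<and> (\<forall>v\<in>X. (v, G X v) \<in> E)" by metis
  define pat where "pat i = {v. v < 10 * t \<and> i \<in> A v}" for i
  have pat: "inj_on (G (pat i)) (pat i)" "\<And>v. v \<in> pat i \<Longrightarrow> (v, G (pat i) v) \<in> E"
    if "i \<in> \<Omega>" for i
    using G[of "pat i"] half[OF that] by (auto simp: pat_def V_def)
  define piece where "piece e = {i\<in>\<Omega>. i \<in> A (fst e) \<and> G (pat i) (fst e) = snd e}" for e
  have A_sub: "A v \<subseteq> \<Omega>" if "v \<in> V" for v
    using A[of v] that sets_into_space by (auto simp: V_def)
  have atom: "{i\<in>\<Omega>. pat i = X} \<in> M" if X: "X \<subseteq> V" for X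
  proof -
    have "{i\<in>\<Omega>. pat i = X} = (\<Inter>v\<in>V. if v \<in> X then A v else \<Omega> - A v)"
    proof (intro set_eqI iffI)
      fix i assume "i \<in> (\<Inter>v\<in>V. if v \<in> X then A v else \<Omega> - A v)"
      then have i: "\<And>v. v \<in> V \<Longrightarrow> i \<in> (if v \<in> X then A v else \<Omega> - A v)" by blast
      have "0 \<in> V" using t by (simp add: V_def)
      then have "i \<in> \<Omega>" using i[of 0] A_sub[of 0] by (auto split: if_splits)
      moreover have "v \<in> pat i \<longleftrightarrow> v \<in> X" for v
        using i[of v] X by (auto simp: pat_def V_def split: if_splits)
      ultimately show "i \<in> {i\<in>\<Omega>. pat i = X}" by blast
    qed (auto simp: pat_def V_def)
    also have "\<dots> \<in> M"
      using A t by (intro finite_INT) (auto simp: V_def lessThan_empty_iff)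
    finally show ?thesis .
  qed
  have piece_M: "piece e \<in> M" if "e \<in> E" for e
  proof -
    have "fst e \<in> V" using that E' by auto
    then have "i \<in> A (fst e) \<longleftrightarrow> fst e \<in> pat i" for i by (simp add: pat_def V_def)
    moreover have "pat i \<subseteq> V" for i by (auto simp: pat_def V_def)
    ultimately have "piece e = (\<Union>X\<in>{X. X \<subseteq> V \<and> fst e \<in> X \<and> G X (fst e) = snd e}. {i\<in>\<Omega>. pat i = X})"
      unfolding piece_def by blast
    also have "\<dots> \<in> M"
      using atom by (intro finite_UN) (auto simp: V_def)
    finally show ?thesis .
  qed
  have row: "f (A v) \<le> (\<Sum>e\<in>{e\<in>E. fst e = v}. f (piece e)) + (real (card {e\<in>E. fst e = v}) - 1)"
    if v: "v \<in> V" for v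
  proof -
    have "(v, G {v} v) \<in> E" using G[of "{v}"] v t by simp
    then have "{e\<in>E. fst e = v} \<noteq> {}" by force
    moreover have "(\<Union>e\<in>{e\<in>E. fst e = v}. piece e) = A v"
    proof (intro set_eqI iffI)
      fix i assume i: "i \<in> A v"
      then have "i \<in> \<Omega>" "v \<in> pat i" using A_sub[OF v] v by (auto simp: pat_def V_def)
      then have "(v, G (pat i) v) \<in> E" "i \<in> piece (v, G (pat i) v)"
        using pat i by (auto simp: piece_def)
      then show "i \<in> (\<Union>e\<in>{e\<in>E. fst e = v}. piece e)" by force
    qed (auto simp: piece_def)
    moreover have "disjoint_family_on piece {e\<in>E. fst e = v}"
      by (auto simp: disjoint_family_on_def piece_def)
    ultimately have "\<bar>f (A v) - (\<Sum>e\<in>{e\<in>E. fst e = v}. f (piece e))\<bar>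
        \<le> real (card {e\<in>E. fst e = v}) - 1"
      using almost_additive_UN[OF alg f(1), of "{e\<in>E. fst e = v}" piece] finE piece_M
      by (auto simp: image_subset_iff)
    then show ?thesis by linarith
  qed
  \<comment> \<open>The pieces at an output unite to a set of value at most \<open>S\<close>, with
    error its degree minus 1. An output without edges is where \<open>1 \<le> S\<close>
    enters.\<close>
  have col: "(\<Sum>e\<in>{e\<in>E. snd e = w}. f (piece e)) \<le> (S - 1) + real (card {e\<in>E. snd e = w})" for w
  proof (cases "{e\<in>E. snd e = w} = {}")
    case False
    have "disjoint_family_on piece {e\<in>E. snd e = w}"
      unfolding disjoint_family_on_def
    proof (intro ballI impI, rule ccontr)
      fix d e assume de: "d \<in> {e\<in>E. snd e = w}" "e \<in> {e\<in>E. snd e = w}" "d \<noteq> e"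
        "piece d \<inter> piece e \<noteq> {}"
      then obtain i where i: "i \<in> piece d" "i \<in> piece e" by blast
      then have "fst d \<in> pat i" "fst e \<in> pat i" "i \<in> \<Omega>"
        using de E' by (auto simp: piece_def pat_def V_def)
      moreover have "G (pat i) (fst d) = G (pat i) (fst e)" using de i by (auto simp: piece_def)
      ultimately have "fst d = fst e" using pat(1)[of i] by (auto dest: inj_onD)
      then show False using de by (auto simp: prod_eq_iff)
    qed
    moreover have "f (\<Union>e\<in>{e\<in>E. snd e = w}. piece e) \<le> S"
      using piece_M finE by (intro f(2) finite_UN) auto
    moreover have "\<bar>f (\<Union>e\<in>{e\<in>E. snd e = w}. piece e) - (\<Sum>e\<in>{e\<in>E. snd e = w}. f (piece e))\<bar>
        \<le> real (card {e\<in>E. snd e = w}) - 1"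
      if "disjoint_family_on piece {e\<in>E. snd e = w}"
      by (rule almost_additive_UN[OF alg f(1) _ False _ that]) (use finE piece_M in auto)
    ultimately show ?thesis by linarith
  next
    case True
    show ?thesis unfolding True using S by simp
  qed
  have proj: "fst ` E \<subseteq> V" "snd ` E \<subseteq> {..<8*t}" using E'(1) by auto
  have finV: "finite V" by (simp add: V_def)
  have fst_card: "(\<Sum>v\<in>V. real (card {e\<in>E. fst e = v})) = real (card E)"
    using sum.group[OF finE finV proj(1), of "\<lambda>_. 1 :: real"] by simp
  have snd_card: "(\<Sum>w<8*t. real (card {e\<in>E. snd e = w})) = real (card E)"
    using sum.group[OF finE _ proj(2), of "\<lambda>_. 1 :: real"] by simp
  \<comment> \<open>Splitting costs \<open>card E - 10 * t\<close> in all and regrouping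
    \<open>card E\<close>, besides \<open>8 * t * (S - 1)\<close>;
    \<open>card E \<le> 40 * t\<close> gives 70.\<close>
  have "(\<Sum>v\<in>V. f (A v))
      \<le> (\<Sum>v\<in>V. (\<Sum>e\<in>{e\<in>E. fst e = v}. f (piece e)) + (real (card {e\<in>E. fst e = v}) - 1))"
    by (intro sum_mono row)
  also have "\<dots> = (\<Sum>e\<in>E. f (piece e)) + real (card E) - 10 * real t"
    using sum.group[OF finE finV proj(1), of "\<lambda>e. f (piece e)"] fst_card
    by (simp add: sum.distrib sum_subtractf) (simp add: V_def)
  also have "(\<Sum>e\<in>E. f (piece e)) = (\<Sum>w<8*t. \<Sum>e\<in>{e\<in>E. snd e = w}. f (piece e))"
    using sum.group[OF finE _ proj(2), of "\<lambda>e. f (piece e)"] by simp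
  also have "\<dots> \<le> (\<Sum>w<8*t. (S - 1) + real (card {e\<in>E. snd e = w}))"
    by (intro sum_mono col)
  also have "\<dots> = 8 * real t * (S - 1) + real (card E)"
    by (simp add: sum.distrib snd_card)
  finally show ?thesis using E'(2) by (simp add: V_def)
qed

section \<open>Contradiction from balanced families\<close>

lemma sum_list_map_le_const: "(\<And>x. x \<in> set xs \<Longrightarrow> g x \<le> c) \<Longrightarrow> sum_list (map g xs) \<le> real (length xs) * c"
  by (induction xs) (auto simp: algebra_simps add_mono)

lemma sum_list_concat_replicate: "sum_list (map g (concat (replicate r xs))) = real r * sum_list (map g xs)"
  by (induction r) (auto simp: algebra_simps)

lemma length_filter_concat_replicate: "length (filter P (concat (replicate r xs))) = r * length (filter P xs)"
  by (induction r) auto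

lemma no_balanced_lists:
  assumes alg: "algebra \<Omega> M" and f: "almost_additive M f" "\<And>B. B \<in> M \<Longrightarrow> \<bar>f B\<bar> \<le> S"
    and S: "37 < S" and sub: "set Ps \<subseteq> M" "set Ns \<subseteq> M"
    and balanced: "\<And>i. i \<in> \<Omega> \<Longrightarrow> length (filter ((\<in>) i) Ps) = length (filter ((\<in>) i) Ns)"
    and le: "length Ns \<le> length Ps"
    and pos: "0 < (\<Sum>A\<leftarrow>Ps. f A - (S - 1/10)) + (\<Sum>B\<leftarrow>Ns. - f B - (S - 1/10))"
  shows False
proof -
  interpret algebra \<Omega> M by fact
  let ?p = "length Ps" and ?n = "length Ns"
  have compl: "\<bar>f \<Omega> - f B - f (\<Omega> - B)\<bar> \<le> 1" if "B \<in> M" for B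
  proof -
    have "B \<union> (\<Omega> - B) = \<Omega>" using sets_into_space[OF that] by blast
    then show ?thesis using f(1) that compl_sets[OF that] unfolding almost_additive_def
      by (metis Diff_disjoint)
  qed
  \<comment> \<open>The terms of \<open>Ns\<close> are at most 1/10 and \<open>Ns\<close> is not the
    longer list, so some \<open>A\<close> in \<open>Ps\<close> has \<open>f A > S - 1/5\<close>. Its
    complement has value at least \<open>- S\<close>, and the union costs 1.\<close>
  have f\<Omega>: "- 6/5 \<le> f \<Omega>"
  proof -
    have "\<exists>A\<in>set Ps. S - 1/5 < f A"
    proof (rule ccontr)
      assume "\<not> (\<exists>A\<in>set Ps. S - 1/5 < f A)"
      then have "(\<Sum>A\<leftarrow>Ps. f A - (S - 1/10)) \<le> real ?p * (- 1/10)"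
        by (intro sum_list_map_le_const) (force simp: not_less)
      moreover have "(\<Sum>B\<leftarrow>Ns. - f B - (S - 1/10)) \<le> real ?n * (1/10)"
        using f(2) sub by (intro sum_list_map_le_const) (force simp: abs_le_iff)
      ultimately show False using pos le by simp
    qed
    then obtain A where A: "A \<in> M" "S - 1/5 < f A" using sub by blast
    show ?thesis using compl[OF A(1)] f(2)[OF compl_sets[OF A(1)]] A(2) by linarith
  qed
  define L where "L = Ps @ map (\<lambda>B. \<Omega> - B) Ns"
  define q where "q = length L"
  have q: "q = ?p + ?n" by (simp add: q_def L_def)
  \<comment> \<open>The loss 11/5 is 6/5 from \<open>f \<Omega>\<close> plus 1 for splitting
    \<open>\<Omega>\<close> into \<open>B\<close> and its complement.\<close>
  have "(\<Sum>B\<leftarrow>Ns. (- f B - (S - 1/10)) - 11/5) \<le> (\<Sum>B\<leftarrow>Ns. f (\<Omega> - B) - (S - 1/10))"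
  proof (rule sum_list_mono)
    fix B assume "B \<in> set Ns"
    then show "(- f B - (S - 1/10)) - 11/5 \<le> f (\<Omega> - B) - (S - 1/10)"
      using compl[of B] f\<Omega> sub(2) by (auto simp: abs_le_iff)
  qed
  then have "(\<Sum>B\<leftarrow>Ns. - f B - (S - 1/10)) - 11/5 * real ?n \<le> (\<Sum>B\<leftarrow>Ns. f (\<Omega> - B) - (S - 1/10))"
    by (subst (asm) sum_list_subtractf) (simp add: sum_list_triv)
  then have "- 11/5 * real ?n < (\<Sum>A\<leftarrow>L. f A - (S - 1/10))"
    using pos by (simp add: L_def o_def)
  also have "\<dots> = (\<Sum>A\<leftarrow>L. f A) - real q * (S - 1/10)"
    by (simp only: sum_list_subtractf q_def sum_list_triv) (simp add: algebra_simps)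
  finally have "real q * (S - 1/10) - 11/5 * real ?n < (\<Sum>A\<leftarrow>L. f A)" by simp
  \<comment> \<open>Complements form at most half of \<open>L\<close>, so the loss averages to at
    most 11/10.\<close>
  moreover have "2 * real ?n \<le> real q" using le q by simp
  moreover have "real q * (S - 6/5) = real q * (S - 1/10) - 11/10 * real q"
    by (simp add: algebra_simps)
  ultimately have L_sum: "real q * (S - 6/5) < (\<Sum>A\<leftarrow>L. f A)" by linarith
  have "q > 0"
  proof (rule ccontr)
    assume "\<not> q > 0"
    then have "Ps = []" "Ns = []" using q by auto
    then show False using pos by simp
  qed
  \<comment> \<open>A point in \<open>k\<close> members of \<open>Ps\<close> lies in
    \<open>k\<close> members of \<open>Ns\<close>, hence in \<open>?n - k\<close> of the
    complements.\<close>
  have L_count: "length (filter ((\<in>) i) L) = ?n" if "i \<in> \<Omega>" for i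
  proof -
    have "length (filter ((\<in>) i) L) = length (filter ((\<in>) i) Ps) + length (filter (\<lambda>B. \<not> i \<in> B) Ns)"
      using that by (simp add: L_def filter_map o_def)
    then show ?thesis
      using balanced[OF that] sum_length_filter_compl[of "(\<in>) i" Ns] by simp
  qed
  obtain N where N: "\<And>t. N \<le> t \<Longrightarrow> (\<Sum>k=1..5*t. bad_ratio t k) < 1"
    using sum_bad_ratio_less_1 unfolding eventually_sequentially by blast
  \<comment> \<open>Repeating the list makes its length \<open>10 * t\<close> with \<open>t\<close> as large as needed.\<close>
  define t where "t = q * Suc N"
  have "1 * Suc N \<le> t" unfolding t_def using \<open>q > 0\<close> by (intro mult_le_mono1) simp
  then have t: "0 < t" "N \<le> t" by auto
  obtain E where E: "concentrator t E" using exists_concentrator[OF N[OF t(2)]] by blast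
  define R where "R = 10 * Suc N"
  have Rq: "R * q = 10 * t" by (simp add: R_def t_def algebra_simps)
  define LL where "LL = concat (replicate R L)"
  have LL: "length LL = 10 * t"
    using length_filter_concat_replicate[of "\<lambda>_. True" R L] Rq by (simp add: LL_def q_def)
  have setLL: "set LL \<subseteq> M" using sub by (auto simp: LL_def L_def)
  have "(\<Sum>v<10 * t. f (LL ! v)) \<le> 70 * real t + 8 * real t * (S - 1)"
  proof (rule sum_le_of_concentrator[OF alg f(1) _ _ t(1) E])
    fix i assume i: "i \<in> \<Omega>"
    have "card {v. v < 10 * t \<and> i \<in> LL ! v} = R * ?n"
      using L_count[OF i] length_filter_conv_card[of "(\<in>) i" LL]
      by (simp add: LL[symmetric]) (simp add: LL_def length_filter_concat_replicate)
    also have "\<dots> \<le> 5 * t"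
    proof -
      have "R * (2 * ?n) \<le> R * q" using le q by (intro mult_le_mono2) simp
      then show ?thesis using Rq by linarith
    qed
    finally show "card {v. v < 10 * t \<and> i \<in> LL ! v} \<le> 5 * t" .
  next
    show "f B \<le> S" if "B \<in> M" for B using f(2)[OF that] by simp
    show "LL ! v \<in> M" if "v < 10 * t" for v
      using subsetD[OF setLL] that by (simp add: LL[symmetric])
  qed (use S in simp)
  moreover have "(\<Sum>v<10 * t. f (LL ! v)) = real R * (\<Sum>A\<leftarrow>L. f A)"
  proof -
    have "(\<Sum>v<10 * t. f (LL ! v)) = (\<Sum>A\<leftarrow>LL. f A)"
      by (simp add: sum_list_sum_nth LL atLeast0LessThan)
    then show ?thesis by (simp only: LL_def sum_list_concat_replicate)
  qed
  moreover have "real R * (real q * (S - 6/5)) < real R * (\<Sum>A\<leftarrow>L. f A)"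
    using L_sum by (simp add: R_def)
  moreover have "real R * (real q * (S - 6/5)) = 10 * real t * (S - 6/5)"
    using arg_cong[OF Rq, of real] by (simp add: mult.assoc[symmetric])
  \<comment> \<open>Divided by \<open>t\<close> this reads \<open>2 * S < 74\<close>, which is where
    the threshold 37 comes from.\<close>
  ultimately have "real t * (10 * (S - 6/5)) < real t * (70 + 8 * (S - 1))"
    by (simp add: algebra_simps)
  then show False using t S by simp
qed

text \<open>Reads a Farkas certificate as two lists with repetition: \<open>Ps\<close> records the
  uses of the bound \<open>K\<close> on \<open>f\<close> minus the additive function,
  \<open>Ns\<close> those of the opposite bound.\<close>

lemma int_cone_lists:
  assumes "p \<in> int_cone ((\<lambda>A. (\<lambda>i. of_bool (i \<in> A), f A - K)) ` M
                      \<union> (\<lambda>A. (\<lambda>i. - of_bool (i \<in> A), - f A - K)) ` M)"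
  shows "\<exists>Ps Ns. set Ps \<subseteq> M \<and> set Ns \<subseteq> M
      \<and> (\<forall>i. fst p i = int (length (filter ((\<in>) i) Ps)) - int (length (filter ((\<in>) i) Ns)))
      \<and> snd p = (\<Sum>A\<leftarrow>Ps. f A - K) + (\<Sum>B\<leftarrow>Ns. - f B - K)"
  using assms
proof induction
  case (base p)
  then consider A where "A \<in> M" "p = (\<lambda>i. of_bool (i \<in> A), f A - K)"
    | A where "A \<in> M" "p = (\<lambda>i. - of_bool (i \<in> A), - f A - K)" by blast
  then show ?case
  proof cases
    case 1
    then show ?thesis by (intro exI[of _ "[A]"] exI[of _ "[]"]) auto
  next
    case 2
    then show ?thesis by (intro exI[of _ "[]"] exI[of _ "[A]"]) auto
  qed
next
  case (add c d c' d')
  from add.IH(1) obtain Ps Ns where L: "set Ps \<subseteq> M" "set Ns \<subseteq> M"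
    "\<forall>i. fst (c, d) i = int (length (filter ((\<in>) i) Ps)) - int (length (filter ((\<in>) i) Ns))"
    "snd (c, d) = (\<Sum>A\<leftarrow>Ps. f A - K) + (\<Sum>B\<leftarrow>Ns. - f B - K)" by blast
  from add.IH(2) obtain Ps' Ns' where L': "set Ps' \<subseteq> M" "set Ns' \<subseteq> M"
    "\<forall>i. fst (c', d') i = int (length (filter ((\<in>) i) Ps')) - int (length (filter ((\<in>) i) Ns'))"
    "snd (c', d') = (\<Sum>A\<leftarrow>Ps'. f A - K) + (\<Sum>B\<leftarrow>Ns'. - f B - K)" by blast
  show ?case
    by (intro exI[of _ "Ps @ Ps'"] exI[of _ "Ns @ Ns'"]) (use L L' in simp)
qed

section \<open>The distance to additive functions\<close>

lemma almost_additive_uminus: "almost_additive M f \<Longrightarrow> almost_additive M (\<lambda>A. - f A)"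
proof -
  have "\<bar>- a - - b - - c\<bar> = \<bar>a - b - c\<bar>" for a b c :: real by simp
  then show "almost_additive M f \<Longrightarrow> almost_additive M (\<lambda>A. - f A)"
    unfolding almost_additive_def by simp
qed

text \<open>The point masses \<open>y\<close> are sought as a solution of finitely many linear
  inequalities with coefficients 0, 1 and -1. A certificate of infeasibility has zero coefficients
  on \<open>\<Omega>\<close>, so its two lists are balanced.\<close>

lemma improve_approximation:
  assumes alg: "algebra \<Omega> M" and fin: "finite \<Omega>"
    and f: "almost_additive M f" "\<And>B. B \<in> M \<Longrightarrow> \<bar>f B\<bar> \<le> S" and S: "37 < S"
  shows "\<exists>y. \<forall>A\<in>M. \<bar>f A - (\<Sum>i\<in>A. y i)\<bar> \<le> S - 1/10"
proof (rule ccontr)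
  assume no: "\<nexists>y. \<forall>A\<in>M. \<bar>f A - (\<Sum>i\<in>A. y i)\<bar> \<le> S - 1/10"
  interpret algebra \<Omega> M by fact
  let ?K = "S - 1/10"
  let ?C = "(\<lambda>A. (\<lambda>i. of_bool (i \<in> A), f A - ?K)) ` M \<union> (\<lambda>A. (\<lambda>i. - of_bool (i \<in> A), - f A - ?K)) ` M"
  have finM: "finite M" using fin space_closed finite_subset by blast
  have "\<nexists>y :: 'a \<Rightarrow> real. \<forall>(c, d)\<in>?C. d \<le> (\<Sum>i\<in>\<Omega>. of_int (c i) * y i)"
  proof
    assume "\<exists>y :: 'a \<Rightarrow> real. \<forall>(c, d)\<in>?C. d \<le> (\<Sum>i\<in>\<Omega>. of_int (c i) * y i)"
    then obtain y :: "'a \<Rightarrow> real" where y0: "\<forall>(c, d)\<in>?C. d \<le> (\<Sum>i\<in>\<Omega>. of_int (c i) * y i)" ..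
    have y: "d \<le> (\<Sum>i\<in>\<Omega>. of_int (c i) * y i)" if "(c, d) \<in> ?C" for c d
      using bspec[OF y0 that] by (simp only: prod.case)
    have "\<bar>f A - (\<Sum>i\<in>A. y i)\<bar> \<le> ?K" if A: "A \<in> M" for A
    proof -
      have "(\<Sum>i\<in>\<Omega>. of_int (of_bool (i \<in> A)) * y i) = (\<Sum>i\<in>A. y i)"
        using sets_into_space[OF A] fin by (intro sum.mono_neutral_cong_right) auto
      then show ?thesis
        using y[of "\<lambda>i. of_bool (i \<in> A)" "f A - ?K"] y[of "\<lambda>i. - of_bool (i \<in> A)" "- f A - ?K"] A
        by (auto simp: sum_negf)
    qed
    then show False using no by blast
  qed
  from farkas_int[OF fin _ this] finM obtain c d
    where cd: "(c, d) \<in> int_cone ?C" "\<And>i. i \<in> \<Omega> \<Longrightarrow> c i = 0" "0 < d" by auto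
  from int_cone_lists[OF cd(1)] obtain Ps Ns where L: "set Ps \<subseteq> M" "set Ns \<subseteq> M"
    "\<And>i. c i = int (length (filter ((\<in>) i) Ps)) - int (length (filter ((\<in>) i) Ns))"
    "d = (\<Sum>A\<leftarrow>Ps. f A - ?K) + (\<Sum>B\<leftarrow>Ns. - f B - ?K)" by auto
  have eq: "length (filter ((\<in>) i) Ps) = length (filter ((\<in>) i) Ns)" if "i \<in> \<Omega>" for i
    using cd(2)[OF that] L(3)[of i] by simp
  show False
  \<comment> \<open>Passing to \<open>- f\<close> exchanges the two lists.\<close>
  proof (cases "length Ns \<le> length Ps")
    case True
    show False
      by (rule no_balanced_lists[OF alg f S L(1,2) eq True]) (use L(4) cd(3) in auto)
  next
    case False
    show False
      by (rule no_balanced_lists[OF alg almost_additive_uminus[OF f(1)] _ S L(2,1) eq[symmetric]])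
        (use False L(4) cd(3) f(2) in auto)
  qed
qed

text \<open>If the infimum of the attained bounds were at least 38, an attained bound less than 1/10
  above it could be lowered by 1/10, beneath the infimum.\<close>

lemma approx_const_38: "approx_const TYPE('a) 38"
  unfolding approx_const_def
proof (intro allI impI, elim conjE)
  fix \<Omega> :: "'a set" and M and \<nu> :: "'a set \<Rightarrow> real"
  assume alg: "algebra \<Omega> M" and finM: "\<forall>A\<in>M. finite A" and \<nu>: "almost_additive M \<nu>"
  interpret algebra \<Omega> M by fact
  have fin: "finite \<Omega>" using finM top by blast
  define F where "F = {S. \<exists>y. \<forall>A\<in>M. \<bar>\<nu> A - (\<Sum>i\<in>A. y i)\<bar> \<le> S}"
  have "Max ((\<lambda>A. \<bar>\<nu> A\<bar>) ` M) \<in> F"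
    using finite_subset[OF space_closed] fin by (auto simp: F_def intro!: exI[of _ "\<lambda>_. 0"])
  then have F_ne: "F \<noteq> {}" by blast
  have F_bdd: "bdd_below F" using empty_sets by (force simp: F_def intro: bdd_belowI[of _ 0])
  have "Inf F < 38"
  proof (rule ccontr)
    assume *: "\<not> Inf F < 38"
    obtain S where S: "S \<in> F" "S < Inf F + 1/10"
      using cInf_lessD[OF F_ne, of "Inf F + 1/10"] by auto
    have "Inf F \<le> S" using S F_bdd by (intro cInf_lower)
    then have S37: "37 < S" using * by simp
    from S(1) obtain y where y: "\<And>A. A \<in> M \<Longrightarrow> \<bar>\<nu> A - (\<Sum>i\<in>A. y i)\<bar> \<le> S" by (auto simp: F_def)
    have "almost_additive M (\<lambda>A. \<nu> A - (\<Sum>i\<in>A. y i))"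
      using \<nu> finM by (simp add: almost_additive_def sum.union_disjoint algebra_simps)
    from improve_approximation[OF alg fin this y S37] obtain z
      where "\<And>A. A \<in> M \<Longrightarrow> \<bar>\<nu> A - (\<Sum>i\<in>A. y i) - (\<Sum>i\<in>A. z i)\<bar> \<le> S - 1/10" by auto
    then have "\<forall>A\<in>M. \<bar>\<nu> A - (\<Sum>i\<in>A. y i + z i)\<bar> \<le> S - 1/10"
      by (simp add: sum.distrib algebra_simps)
    then have "S - 1/10 \<in> F" unfolding F_def mem_Collect_eq by (intro exI[of _ "\<lambda>i. y i + z i"])
    then have "Inf F \<le> S - 1/10" using F_bdd by (intro cInf_lower)
    then show False using S by simp
  qed
  then obtain S where "S \<in> F" "S < 38" using cInf_lessD[OF F_ne] by blast
  then obtain y where y: "\<And>A. A \<in> M \<Longrightarrow> \<bar>\<nu> A - (\<Sum>i\<in>A. y i)\<bar> \<le> S" by (auto simp: F_def)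
  show "\<exists>\<mu>. additive M \<mu> \<and> (\<forall>A\<in>M. \<bar>\<nu> A - \<mu> A\<bar> \<le> 38)"
  proof (intro exI conjI ballI)
    show "additive M (\<lambda>A. \<Sum>i\<in>A. y i)"
      using finM by (simp add: additive_def sum.union_disjoint)
  qed (use y \<open>S < 38\<close> in force)
qed

text \<open>\<open>\<Omega>\<close> lies in \<open>M\<close>, so it is finite and embeds into the
  naturals; the algebra and \<open>\<nu>\<close> are carried along the embedding and the
  approximation is pulled back.\<close>

lemma approx_const_transfer:
  assumes K: "approx_const TYPE(nat) K"
  shows "approx_const TYPE('a) K"
  unfolding approx_const_def
proof (intro allI impI, elim conjE)
  fix \<Omega> :: "'a set" and M and \<nu> :: "'a set \<Rightarrow> real"
  assume alg: "algebra \<Omega> M" and finM: "\<forall>A\<in>M. finite A" and \<nu>: "almost_additive M \<nu>"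
  interpret algebra \<Omega> M by fact
  have "finite \<Omega>" using finM top by blast
  then obtain h :: "'a \<Rightarrow> nat" where h: "inj_on h \<Omega>" using finite_imp_inj_to_nat_seg by blast
  define \<nu>' where "\<nu>' B = \<nu> (h -` B \<inter> \<Omega>)" for B
  let ?M = "(`) h ` M"
  have \<nu>': "\<nu>' (h ` A) = \<nu> A" if "A \<in> M" for A
  proof -
    have "h -` (h ` A) \<inter> \<Omega> = A" using h sets_into_space[OF that] by (auto dest: inj_onD)
    then show ?thesis by (simp add: \<nu>'_def)
  qed
  have disj: "h ` A \<inter> h ` B = {} \<longleftrightarrow> A \<inter> B = {}" if "A \<in> M" "B \<in> M" for A B
    using inj_on_image_Int[OF h sets_into_space sets_into_space] that by (metis image_is_empty)
  have "algebra (h ` \<Omega>) ?M"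
    unfolding algebra_iff_Un
  proof (intro conjI ballI)
    show "?M \<subseteq> Pow (h ` \<Omega>)" using sets_into_space by blast
  next
    fix C assume "C \<in> ?M"
    then obtain A where A: "A \<in> M" "C = h ` A" by blast
    then have "h ` \<Omega> - C = h ` (\<Omega> - A)"
      using inj_on_image_set_diff[OF h _ sets_into_space[OF A(1)], of \<Omega>] by auto
    then show "h ` \<Omega> - C \<in> ?M" using A by blast
  next
    fix C D assume "C \<in> ?M" "D \<in> ?M"
    then obtain A B where "A \<in> M" "B \<in> M" "C \<union> D = h ` (A \<union> B)" by blast
    then show "C \<union> D \<in> ?M" by blast
  qed auto
  moreover have "\<forall>A\<in>?M. finite A" using finM by blast
  moreover have "almost_additive ?M \<nu>'"
    using \<nu> by (auto simp: almost_additive_def image_Un[symmetric] \<nu>' \<nu>'[OF Un] disj)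
  ultimately obtain \<mu>' where \<mu>': "additive ?M \<mu>'" "\<forall>A\<in>?M. \<bar>\<nu>' A - \<mu>' A\<bar> \<le> K"
    using K unfolding approx_const_def by blast
  show "\<exists>\<mu>. additive M \<mu> \<and> (\<forall>A\<in>M. \<bar>\<nu> A - \<mu> A\<bar> \<le> K)"
  proof (intro exI conjI ballI)
    show "additive M (\<lambda>A. \<mu>' (h ` A))"
      using \<mu>'(1) by (auto simp: additive_def image_Un disj)
    show "\<bar>\<nu> A - \<mu>' (h ` A)\<bar> \<le> K" if "A \<in> M" for A
      using \<mu>'(2) \<nu>'[OF that] that by fastforce
  qed
qed

(* In "\<exists>K<39. approx_const TYPE('a) K" alone, the constant could depend on the type 'a.
   Here the bound variable of the first conjunct is independent of 'a, and the second conjunct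
   says that the same constant serves every type of points. *)
theorem corollary1p2:
  shows "(\<exists>K<39. approx_const TYPE(nat) K) \<and>
         (\<forall>K. approx_const TYPE(nat) K \<longrightarrow> approx_const TYPE('a) K)"
proof
  show "\<exists>K<39. approx_const TYPE(nat) K"
    using approx_const_38 by (intro exI[of _ 38]) simp
qed (blast intro: approx_const_transfer)

end
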